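(* For every subset $K\subset I=\{1,\dots,p\}$, one has $\xi_K=0$ if and only if $I_1\subset K$.
   Context: Setting. Let $(\Omega,\mathcal A,P)$ be a probability space, $X=(X^{(1)},\dots,X^{(p)})^T$ a random vector in $\mathbb R^p$ with $\mathbb E(\|X\|^4)<+\infty$ ($\|\cdot\|$ the Euclidean norm), $Y=(Y^{(1)},\dots,Y^{(d)})^T$ a random vector in $\{0,1\}^d$, and $Z$ a random variable with values in $\{1,\dots,q\}$, $q\ge 2$. Put $M=2^d$ and $U=1+\sum_{j=1}^d Y^{(j)}2^{j-1}\in\{1,\dots,M\}$. For $1\le \ell\le q$, $1\le m\le M$ put $p_m=P(U=m)$, $p_{\ell|m}=P(Z=\ell\mid U=m)$, $\mu_m=\mathbb E(X\mid U=m)$, $\mu_{\ell,m}=\mathbb E(X\mid Z=\ell,U=m)$; it is assumed that $p_m>0$ and $p_{\ell|m}>0$ for all $\ell,m$. For $u,v\in\mathbb R^p$, $u\otimes v$ is the linear map $h\mapsto\langle u,h\rangle v$, with $\langle\cdot,\cdot\rangle$ the Euclidean inner product. Put $V_m=\mathbb E\big((X-\mu_m)\otimes(X-\mu_m)\mid U=m\big)$, assumed invertible for every $m$. Criterion. Let $I=\{1,\dots,p\}$. For $K\subset I$ let $A_K:\mathbb R^p\to\mathbb R^{\mathrm{card}(K)}$, $x=(x_i)_{i\in I}\mapsto (x_i)_{i\in K}$, with adjoint $A_K^*$, and let $Q_{K|m}=A_K^*(A_KV_mA_K^* )^{-1}A_K$ (so $Q_{\varnothing|m}=0$). With $I_{\mathbb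 R^p}$ the identity operator, $$\xi_{K|m}=\sum_{\ell=1}^q p_{\ell|m}^2\,\big\|(I_{\mathbb R^p}-V_mQ_{K|m})(\mu_{\ell,m}-\mu_m)\big\|^2,\qquad \xi_K=\sum_{m=1}^M p_m^2\,\xi_{K|m}.$$ The set $I_1$. For each $m$ let $B_m=\sum_{\ell=1}^q p_{\ell|m}(\mu_{\ell,m}-\mu_m)\otimes(\mu_{\ell,m}-\mu_m)$ and $T_m=V_m^{-1}B_m$. Let $\lambda_{1,m}\ge\dots\ge\lambda_{p,m}$ be the eigenvalues of $T_m$ and $\upsilon_i^m=(\upsilon_{i1}^m,\dots,\upsilon_{ip}^m)^T$, $i=1,\dots,p$, be linearly independent eigenvectors of $T_m$, with $\upsilon_i^m$ associated with $\lambda_{i,m}$. Let $r_m$ be the rank of $T_m$ (the number of nonzero eigenvalues counted with multiplicity). Put $$I_{1,m}=\{k\in I:\ \exists i\in\{1,\dots,r_m\},\ \upsilon_{ik}^m\neq 0\},\qquad I_1=\bigcup_{m=1}^M I_{1,m}.$$ *)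

theory Defs
  imports "HOL-Probability.Probability"
begin

section \<open>Conditioning on an event\<close>

text \<open>
  The elementary conditional expectation \<open>\<bbbE>(f | E) = \<bbbE>(f 1\<^sub>E) / P(E)\<close>; the events of interest have
  positive probability. Conditional probabilities are the library's \<^const>\<open>cond_prob\<close>.
\<close>

definition cond_mean ::
    "'a measure \<Rightarrow> ('a \<Rightarrow> 'b::{banach, second_countable_topology}) \<Rightarrow> ('a \<Rightarrow> bool) \<Rightarrow> 'b"
  where "cond_mean P f E =
    (LINT \<omega>:{\<omega> \<in> space P. E \<omega>}|P. f \<omega>) /\<^sub>R \<P>(\<omega> in P. E \<omega>)"

definition cell :: "nat \<Rightarrow> (nat \<Rightarrow> 'a \<Rightarrow> nat) \<Rightarrow> 'a \<Rightarrow> nat"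
  where "cell d Y \<omega> = 1 + (\<Sum>j = 1..d. Y j \<omega> * 2 ^ (j - 1))"

definition cell_prob :: "'a measure \<Rightarrow> ('a \<Rightarrow> nat) \<Rightarrow> nat \<Rightarrow> real"
  where "cell_prob P U m = \<P>(\<omega> in P. U \<omega> = m)"

definition group_prob :: "'a measure \<Rightarrow> ('a \<Rightarrow> nat) \<Rightarrow> ('a \<Rightarrow> nat) \<Rightarrow> nat \<Rightarrow> nat \<Rightarrow> real"
  where "group_prob P U Z l m = \<P>(\<omega> in P. Z \<omega> = l \<bar> U \<omega> = m)"

definition cell_mean :: "'a measure \<Rightarrow> ('a \<Rightarrow> real ^ 'p) \<Rightarrow> ('a \<Rightarrow> nat) \<Rightarrow> nat \<Rightarrow> real ^ 'p"
  where "cell_mean P X U m = cond_mean P X (\<lambda>\<omega>. U \<omega> = m)"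

definition group_mean ::
    "'a measure \<Rightarrow> ('a \<Rightarrow> real ^ 'p) \<Rightarrow> ('a \<Rightarrow> nat) \<Rightarrow> ('a \<Rightarrow> nat) \<Rightarrow> nat \<Rightarrow> nat \<Rightarrow> real ^ 'p"
  where "group_mean P X U Z l m = cond_mean P X (\<lambda>\<omega>. Z \<omega> = l \<and> U \<omega> = m)"


section \<open>Covariance operators\<close>

text \<open>
  Operators on \<open>\<real>\<^sup>p\<close> are represented by their matrices, so that they form a Euclidean space in
  which the Bochner integral is available.
\<close>

definition tensor :: "real ^ 'p \<Rightarrow> real ^ 'p \<Rightarrow> real ^ 'p ^ 'p"
  where "tensor u v = matrix (\<lambda>h. (u \<bullet> h) *\<^sub>R v)"

definition cell_cov :: "'a measure \<Rightarrow> ('a \<Rightarrow> real ^ 'p) \<Rightarrow> ('a \<Rightarrow> nat) \<Rightarrow> nat \<Rightarrow> real ^ 'p ^ 'p"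
  where "cell_cov P X U m =
    cond_mean P (\<lambda>\<omega>. tensor (X \<omega> - cell_mean P X U m) (X \<omega> - cell_mean P X U m))
      (\<lambda>\<omega>. U \<omega> = m)"

definition between_cov ::
    "'a measure \<Rightarrow> ('a \<Rightarrow> real ^ 'p) \<Rightarrow> ('a \<Rightarrow> nat) \<Rightarrow> ('a \<Rightarrow> nat) \<Rightarrow> nat \<Rightarrow> nat \<Rightarrow> real ^ 'p ^ 'p"
  where "between_cov P X U Z q m =
    (\<Sum>l = 1..q. group_prob P U Z l m *\<^sub>R
      tensor (group_mean P X U Z l m - cell_mean P X U m)
             (group_mean P X U Z l m - cell_mean P X U m))"

definition discr_op ::
    "'a measure \<Rightarrow> ('a \<Rightarrow> real ^ 'p) \<Rightarrow> ('a \<Rightarrow> nat) \<Rightarrow> ('a \<Rightarrow> nat) \<Rightarrow> nat \<Rightarrow> nat \<Rightarrow> real ^ 'p ^ 'p"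
  where "discr_op P X U Z q m = matrix_inv (cell_cov P X U m) ** between_cov P X U Z q m"


section \<open>Coordinate projections and the criterion\<close>

text \<open>
  The index set \<open>I\<close> is the whole type \<^typ>\<open>'p\<close>. For a subset \<open>K\<close>, the space of families
  \<open>(x\<^sub>i)\<^sub>i\<^sub>\<in>\<^sub>K\<close> is \<^term>\<open>extensional K\<close>, i.e. the functions that are \<^const>\<open>undefined\<close> outside \<open>K\<close>,
  with inner product \<open>\<Sum>i\<in>K. y i * z i\<close>. It is one point if \<open>K\<close> is empty.
\<close>

definition proj :: "'p set \<Rightarrow> real ^ 'p \<Rightarrow> 'p \<Rightarrow> real"
  where "proj K x = restrict (\<lambda>i. x $ i) K"

definition proj_adj :: "'p::finite set \<Rightarrow> ('p \<Rightarrow> real) \<Rightarrow> real ^ 'p"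
  where "proj_adj K y = (THE x. \<forall>h. (\<Sum>i\<in>K. proj K h i * y i) = h \<bullet> x)"

lemma proj_adj_eq: "proj_adj K y = (\<chi> i. if i \<in> K then y i else 0)"
  unfolding proj_adj_def
proof (rule the_equality)
  have *: "(\<Sum>i\<in>K. proj K h i * y i) = h \<bullet> (\<chi> i. if i \<in> K then y i else 0)" for h
    by (simp add: proj_def inner_vec_def if_distrib sum.If_cases cong: if_cong)
  then show "\<forall>h. (\<Sum>i\<in>K. proj K h i * y i) = h \<bullet> (\<chi> i. if i \<in> K then y i else 0)"
    by blast
  fix x assume "\<forall>h. (\<Sum>i\<in>K. proj K h i * y i) = h \<bullet> x"
  with * have "\<forall>h. h \<bullet> x = h \<bullet> (\<chi> i. if i \<in> K then y i else 0)"
    by simp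
  then show "x = (\<chi> i. if i \<in> K then y i else 0)"
    by (simp only: vector_eq_ldot)
qed

text \<open>
  \<open>Q\<^sub>K = A\<^sub>K\<^sup>* (A\<^sub>K V A\<^sub>K\<^sup>*)\<^sup>-\<^sup>1 A\<^sub>K\<close>, where the middle factor is an inverse of a map from
  \<^term>\<open>extensional K\<close> to itself. That map is bijective if \<open>V\<close> is symmetric positive definite.
\<close>

definition Q_op :: "real ^ 'p ^ 'p \<Rightarrow> 'p set \<Rightarrow> real ^ 'p ^ 'p"
  where "Q_op V K =
    matrix (\<lambda>h. proj_adj K
      (the_inv_into (extensional K) (\<lambda>y. proj K (V *v proj_adj K y)) (proj K h)))"

lemma Q_op_empty: "Q_op V {} = 0"
  by (simp add: Q_op_def matrix_def proj_adj_eq vec_eq_iff)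

definition xi_cell ::
    "'a measure \<Rightarrow> ('a \<Rightarrow> real ^ 'p) \<Rightarrow> ('a \<Rightarrow> nat) \<Rightarrow> ('a \<Rightarrow> nat) \<Rightarrow> nat \<Rightarrow> 'p set \<Rightarrow> nat \<Rightarrow> real"
  where "xi_cell P X U Z q K m =
    (\<Sum>l = 1..q. (group_prob P U Z l m)\<^sup>2 *
      (norm ((mat 1 - cell_cov P X U m ** Q_op (cell_cov P X U m) K) *v
             (group_mean P X U Z l m - cell_mean P X U m)))\<^sup>2)"

definition xi ::
    "'a measure \<Rightarrow> ('a \<Rightarrow> real ^ 'p) \<Rightarrow> ('a \<Rightarrow> nat) \<Rightarrow> ('a \<Rightarrow> nat) \<Rightarrow> nat \<Rightarrow> nat \<Rightarrow> 'p set \<Rightarrow> real"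
  where "xi P X U Z q M K = (\<Sum>m = 1..M. (cell_prob P U m)\<^sup>2 * xi_cell P X U Z q K m)"


section \<open>Eigenvectors and the relevant indices\<close>

definition ordered_eigenbasis :: "real ^ 'p ^ 'p \<Rightarrow> (nat \<Rightarrow> real) \<Rightarrow> (nat \<Rightarrow> real ^ 'p) \<Rightarrow> bool"
  where "ordered_eigenbasis T lam v \<longleftrightarrow>
    (\<forall>i\<in>{1..CARD('p)}. \<forall>j\<in>{1..CARD('p)}. i \<le> j \<longrightarrow> lam j \<le> lam i) \<and>
    (\<forall>i\<in>{1..CARD('p)}. v i \<noteq> 0 \<and> T *v v i = lam i *\<^sub>R v i) \<and>
    inj_on v {1..CARD('p)} \<and> independent (v ` {1..CARD('p)})"

definition relevant_cell :: "real ^ 'p ^ 'p \<Rightarrow> (nat \<Rightarrow> real ^ 'p) \<Rightarrow> 'p set"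
  where "relevant_cell T v = {k. \<exists>i\<in>{1..rank T}. v i $ k \<noteq> 0}"

definition relevant :: "nat \<Rightarrow> (nat \<Rightarrow> real ^ 'p ^ 'p) \<Rightarrow> (nat \<Rightarrow> nat \<Rightarrow> real ^ 'p) \<Rightarrow> 'p set"
  where "relevant M T v = (\<Union>m\<in>{1..M}. relevant_cell (T m) (v m))"

end

theory Submission
  imports Defs
begin

text \<open>
  Fix a cell \<open>m\<close> and write \<open>V\<close> for its covariance matrix, \<open>\<delta>\<^sub>l\<close> for the centred group means,
  \<open>B = \<Sum>\<^sub>l p\<^sub>l \<delta>\<^sub>l \<otimes> \<delta>\<^sub>l\<close> and \<open>T = V\<^sup>-\<^sup>1 B\<close>. A covariance matrix is symmetric and positive
  semidefinite, hence positive definite when it is invertible. Let \<open>S\<^sub>K\<close> be the space of vectors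
  that vanish outside \<open>K\<close>. Both sides of the equivalence say that the range of \<open>T\<close> lies in \<open>S\<^sub>K\<close>,
  for every cell.

  For the criterion: \<open>Q h\<close> is the only vector in \<open>S\<^sub>K\<close> whose image under \<open>V\<close> agrees with \<open>h\<close> on
  \<open>K\<close>, so \<open>V Q h = h\<close> means exactly that \<open>V\<^sup>-\<^sup>1 h\<close> is in \<open>S\<^sub>K\<close> (\<open>Q_op_residual_eq_0_iff\<close>). As the weights are
  positive, the criterion vanishes iff \<open>V\<^sup>-\<^sup>1 \<delta>\<^sub>l \<in> S\<^sub>K\<close> for all \<open>l\<close>. The range of \<open>B\<close> is the span of the
  \<open>\<delta>\<^sub>l\<close> (\<open>mem_range_tensor_sum\<close>), so the range of \<open>T\<close> is the span of the \<open>V\<^sup>-\<^sup>1 \<delta>\<^sub>l\<close>.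

  For the index set: the range of \<open>T\<close> is spanned by the eigenvectors with nonzero eigenvalue. The
  eigenvalues satisfy \<open>\<langle>x, B x\<rangle> = \<lambda> \<langle>x, V x\<rangle>\<close>, so they are nonnegative; being in decreasing order, the
  nonzero ones are the first \<open>rank T\<close> of them (\<open>ordered_eigenbasis_nonzero\<close>). Hence the range of
  \<open>T\<close> lies in \<open>S\<^sub>K\<close> iff those eigenvectors do, that is, iff \<open>K\<close> contains every relevant index.
\<close>

section \<open>Positive definite matrices\<close>

definition symmetric_form :: "real ^ 'p ^ 'p \<Rightarrow> bool"
  where "symmetric_form V \<longleftrightarrow> (\<forall>h k. h \<bullet> (V *v k) = k \<bullet> (V *v h))"

definition pos_def :: "real ^ 'p ^ 'p \<Rightarrow> bool"
  where "pos_def V \<longleftrightarrow> symmetric_form V \<and> (\<forall>h. h \<noteq> 0 \<longrightarrow> h \<bullet> (V *v h) > 0)"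

text \<open>
  At a zero \<open>h\<close> of the quadratic form, \<open>t \<mapsto> \<langle>h + t w, V (h + t w)\<rangle>\<close> is nonnegative with linear term
  \<open>2 t \<langle>w, V h\<rangle>\<close>; for \<open>w = V h\<close> a small negative \<open>t\<close> forces \<open>V h = 0\<close>.
\<close>

lemma psd_form_eq_0D:
  fixes V :: "real ^ 'p ^ 'p"
  assumes sym: "symmetric_form V" and psd: "\<And>h. h \<bullet> (V *v h) \<ge> 0" and 0: "h \<bullet> (V *v h) = 0"
  shows "V *v h = 0"
proof (rule ccontr)
  assume ne: "V *v h \<noteq> 0"
  define w a c where "w = V *v h" and "a = w \<bullet> w" and "c = w \<bullet> (V *v w)"
  have a: "a > 0" and c: "c \<ge> 0"
    using ne psd[of w] by (auto simp: a_def c_def w_def)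
  have hw: "h \<bullet> (V *v w) = a"
    using sym unfolding symmetric_form_def a_def by (metis w_def)
  \<comment> \<open>The minimiser would be \<open>- a / c\<close>; adding \<open>1\<close> to the denominator also covers \<open>c = 0\<close>.\<close>
  define t where "t = - a / (c + 1)"
  have "(h + t *\<^sub>R w) \<bullet> (V *v (h + t *\<^sub>R w)) = 2 * t * a + t\<^sup>2 * c"
    using 0 hw
    by (simp add: matrix_vector_right_distrib matrix_vector_mult_scaleR inner_add_left
        inner_add_right power2_eq_square algebra_simps flip: a_def c_def w_def)
  then have "2 * t * a + t\<^sup>2 * c \<ge> 0"
    using psd[of "h + t *\<^sub>R w"] by simp
  moreover have "2 * t * a + t\<^sup>2 * c = - (t\<^sup>2 * (c + 2))"
  proof -
    have a_t: "a = - t * (c + 1)"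
      using c by (simp add: t_def)
    show ?thesis
      unfolding a_t by (simp add: algebra_simps power2_eq_square)
  qed
  moreover have "t\<^sup>2 * (c + 2) > 0"
    using a c by (simp add: t_def)
  ultimately show False by linarith
qed

lemma matrix_inv_cancel:
  fixes V :: "real ^ 'p ^ 'p"
  assumes "invertible V"
  shows "matrix_inv V *v (V *v h) = h" "V *v (matrix_inv V *v h) = h"
proof -
  have "V ** matrix_inv V = mat 1 \<and> matrix_inv V ** V = mat 1"
    unfolding matrix_inv_def using assms unfolding invertible_def by (rule someI_ex)
  then show "matrix_inv V *v (V *v h) = h" "V *v (matrix_inv V *v h) = h"
    by (simp_all add: matrix_vector_mul_assoc)
qed

lemma invertible_psd_imp_pos_def:
  fixes V :: "real ^ 'p ^ 'p"
  assumes "symmetric_form V" "\<And>h. h \<bullet> (V *v h) \<ge> 0" "invertible V"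
  shows "pos_def V"
proof -
  have "h = 0" if "h \<bullet> (V *v h) = 0" for h
    using psd_form_eq_0D[OF assms(1,2) that] matrix_inv_cancel(1)[OF assms(3), of h] by simp
  then show ?thesis
    unfolding pos_def_def using assms(1,2) by (metis order_le_less)
qed

section \<open>The cell covariance\<close>

text \<open>
  A mean of values in a closed half-space through the origin stays in it. The Bochner integral of a
  function that is not integrable is \<open>0\<close>, which also lies in the half-space.
\<close>

lemma cond_mean_halfspace:
  fixes \<phi> :: "'b::{banach, second_countable_topology} \<Rightarrow> real"
  assumes "bounded_linear \<phi>" and nonneg: "\<And>\<omega>. \<phi> (f \<omega>) \<ge> 0"
  shows "\<phi> (cond_mean P f E) \<ge> 0"
proof -
  interpret bounded_linear \<phi> by fact
  let ?g = "\<lambda>\<omega>. indicator {\<omega> \<in> space P. E \<omega>} \<omega> *\<^sub>R f \<omega>"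
  have "\<phi> (LINT \<omega>|P. ?g \<omega>) \<ge> 0"
  proof (cases "integrable P ?g")
    case True
    have "\<phi> (LINT \<omega>|P. ?g \<omega>) = (LINT \<omega>|P. \<phi> (?g \<omega>))"
      using integral_bounded_linear[OF assms(1) True] by simp
    also have "\<dots> \<ge> 0"
      by (intro Bochner_Integration.integral_nonneg) (simp add: scaleR nonneg)
    finally show ?thesis .
  qed (simp add: not_integrable_integral_eq zero)
  then show ?thesis
    by (simp add: cond_mean_def set_lebesgue_integral_def scaleR)
qed

lemma tensor_vector_mult: "tensor u v *v h = (u \<bullet> h) *\<^sub>R v"
  unfolding tensor_def
  by (rule matrix_works)
    (auto intro!: linearI simp: linear_matrix_vector_mul_eq inner_add_right scaleR_add_left)

lemma bounded_linear_matrix_form: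
  fixes h :: "real ^ 'm" and k :: "real ^ 'n"
  shows "bounded_linear (\<lambda>A :: real ^ 'n ^ 'm. h \<bullet> (A *v k))"
  unfolding linear_conv_bounded_linear[symmetric]
  by (rule linearI)
    (simp_all add: matrix_vector_mult_add_rdistrib inner_add_right
      flip: scaleR_matrix_vector_assoc)

lemma cell_cov_symmetric: "symmetric_form (cell_cov P X U m)"
proof -
  have "h \<bullet> (cell_cov P X U m *v k) - k \<bullet> (cell_cov P X U m *v h) \<ge> 0" for h k
    unfolding cell_cov_def
    by (rule cond_mean_halfspace[where \<phi> = "\<lambda>A. h \<bullet> (A *v k) - k \<bullet> (A *v h)"])
      (auto intro: bounded_linear_sub bounded_linear_matrix_form
        simp: tensor_vector_mult inner_commute)
  then show ?thesis
    unfolding symmetric_form_def by (smt (verit))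
qed

lemma cell_cov_psd: "h \<bullet> (cell_cov P X U m *v h) \<ge> 0"
  unfolding cell_cov_def
  by (rule cond_mean_halfspace[where \<phi> = "\<lambda>A. h \<bullet> (A *v h)"])
    (auto intro: bounded_linear_matrix_form simp: tensor_vector_mult inner_commute)

section \<open>The coordinate-restricted inverse\<close>

definition supported_on :: "'p set \<Rightarrow> (real ^ 'p) set"
  where "supported_on K = {x. \<forall>i. i \<notin> K \<longrightarrow> x $ i = 0}"

lemma subspace_supported_on: "subspace (supported_on K)"
  by (auto simp: subspace_def supported_on_def)

lemma inner_supported_on_eq_0:
  assumes "x \<in> supported_on K" "\<And>i. i \<in> K \<Longrightarrow> y $ i = 0"
  shows "x \<bullet> y = 0"
  using assms unfolding inner_vec_def supported_on_def
  by (intro sum.neutral) (metis (mono_tags, lifting) inner_zero_left inner_zero_right mem_Collect_eq)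

lemma restricted_solution_unique:
  fixes V :: "real ^ 'p ^ 'p"
  assumes V: "pos_def V" and x: "x \<in> supported_on K" and y: "y \<in> supported_on K"
    and eq: "\<And>i. i \<in> K \<Longrightarrow> (V *v x) $ i = (V *v y) $ i"
  shows "x = y"
proof -
  have "x - y \<in> supported_on K"
    using x y subspace_supported_on by (rule subspace_diff[rotated])
  then have "(x - y) \<bullet> (V *v (x - y)) = 0"
    by (rule inner_supported_on_eq_0) (simp add: matrix_vector_mult_diff_distrib eq)
  then show ?thesis
    using V unfolding pos_def_def by (metis less_irrefl right_minus_eq)
qed

text \<open>
  Extend the compression of \<open>V\<close> to \<open>K\<close> by the identity on the remaining coordinates. This is an
  endomorphism of the full space, and it is injective by uniqueness, so it is onto.
\<close>

lemma restricted_solution_exists: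
  fixes V :: "real ^ 'p ^ 'p"
  assumes V: "pos_def V"
  shows "\<exists>x \<in> supported_on K. \<forall>i\<in>K. (V *v x) $ i = h $ i"
proof -
  define c where "c x = (\<chi> i. if i \<in> K then x $ i else 0)" for x :: "real ^ 'p"
  define L where "L x = (\<chi> i. if i \<in> K then (V *v c x) $ i else x $ i)" for x :: "real ^ 'p"
  have c_supp: "c x \<in> supported_on K" for x
    by (simp add: c_def supported_on_def)
  have c_add: "c (x + y) = c x + c y" and c_scale: "c (r *\<^sub>R x) = r *\<^sub>R c x" for x y r
    by (simp_all add: c_def vec_eq_iff)
  have lin: "linear L"
    by (rule linearI) (simp_all add: L_def vec_eq_iff c_add c_scale
        matrix_vector_right_distrib matrix_vector_mult_scaleR)
  have "x = 0" if "L x = 0" for x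
  proof -
    have *: "\<And>i. i \<in> K \<Longrightarrow> (V *v c x) $ i = 0" "\<And>i. i \<notin> K \<Longrightarrow> x $ i = 0"
      using that unfolding L_def vec_eq_iff by (auto split: if_splits dest: spec)
    have "c x = 0"
      by (rule restricted_solution_unique[OF V c_supp])
        (auto simp: * subspace_0 subspace_supported_on)
    then have "x $ i = 0" for i
      using *(2)[of i] by (cases "i \<in> K") (auto simp: c_def vec_eq_iff dest: spec[where x = i])
    then show "x = 0"
      by (simp add: vec_eq_iff)
  qed
  then have "surj L"
    using lin by (intro linear_injective_imp_surjective) (simp_all add: linear_injective_0)
  then obtain x where x: "h = L x"
    by blast
  have "(V *v c x) $ i = h $ i" if "i \<in> K" for i
    using that by (simp add: x L_def)
  with c_supp show ?thesis
    by blast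
qed

lemma proj_adj_supported_on: "proj_adj K y \<in> supported_on K"
  by (simp add: proj_adj_eq supported_on_def)

lemma proj_adj_inj:
  assumes "y \<in> extensional K" "z \<in> extensional K" "proj_adj K y = proj_adj K z"
  shows "y = z"
proof (rule extensionalityI[OF assms(1,2)])
  fix i assume "i \<in> K"
  then show "y i = z i"
    using arg_cong[OF assms(3), of "\<lambda>x. x $ i"] by (simp add: proj_adj_eq)
qed

lemma proj_eq_iff: "proj K x = proj K y \<longleftrightarrow> (\<forall>i\<in>K. x $ i = y $ i)"
  by (auto simp: proj_def restrict_def fun_eq_iff)

lemma proj_adj_proj: "x \<in> supported_on K \<Longrightarrow> proj_adj K (proj K x) = x"
  by (auto simp: proj_adj_eq proj_def supported_on_def vec_eq_iff)

text \<open>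
  The operator \<open>Q\<close> is specified as the matrix of a map. The map sends \<open>h\<close> to the solution of the
  system on \<open>K\<close>; uniqueness of that solution makes it linear, so the matrix represents it.
\<close>

lemma Q_op_solves:
  fixes V :: "real ^ 'p ^ 'p"
  assumes V: "pos_def V"
  shows "Q_op V K *v h \<in> supported_on K" "i \<in> K \<Longrightarrow> (V *v (Q_op V K *v h)) $ i = h $ i"
proof -
  define g where "g y = proj K (V *v proj_adj K y)" for y
  define F where "F h = proj_adj K (the_inv_into (extensional K) g (proj K h))" for h
  have inj: "inj_on g (extensional K)"
  proof (rule inj_onI)
    fix y z assume yz: "y \<in> extensional K" "z \<in> extensional K" and "g y = g z"
    then have "proj_adj K y = proj_adj K z"
      by (intro restricted_solution_unique[OF V proj_adj_supported_on proj_adj_supported_on])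
        (auto simp: g_def proj_eq_iff)
    with yz show "y = z"
      by (rule proj_adj_inj)
  qed
  have F: "F h = x" if x: "x \<in> supported_on K" "\<And>i. i \<in> K \<Longrightarrow> (V *v x) $ i = h $ i" for h x
  proof -
    have "g (proj K x) = proj K h"
      using x by (simp add: g_def proj_adj_proj proj_eq_iff)
    then have "the_inv_into (extensional K) g (proj K h) = proj K x"
      by (intro the_inv_into_f_eq[OF inj]) (auto simp: proj_def)
    then show ?thesis
      using x by (simp add: F_def proj_adj_proj)
  qed
  have F_supp: "F h \<in> supported_on K" for h
    by (simp add: F_def proj_adj_supported_on)
  have F_sol: "(V *v F h) $ i = h $ i" if "i \<in> K" for h i
    using restricted_solution_exists[OF V, of K h] F that by metis
  have "linear F"
  proof (rule linearI)
    show "F (x + y) = F x + F y" for x y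
      by (rule F) (simp_all add: F_supp F_sol subspace_add[OF subspace_supported_on]
          matrix_vector_right_distrib)
    show "F (r *\<^sub>R x) = r *\<^sub>R F x" for r x
      by (rule F) (simp_all add: F_supp F_sol subspace_scale[OF subspace_supported_on]
          matrix_vector_mult_scaleR)
  qed
  moreover have "Q_op V K = matrix F"
    by (simp add: Q_op_def F_def[abs_def] g_def[abs_def])
  ultimately have "Q_op V K *v h = F h"
    by (simp add: matrix_works linear_matrix_vector_mul_eq)
  then show "Q_op V K *v h \<in> supported_on K" "i \<in> K \<Longrightarrow> (V *v (Q_op V K *v h)) $ i = h $ i"
    by (simp_all add: F_supp F_sol)
qed

text \<open>
  If \<open>V Q h = h\<close>, then \<open>V\<^sup>-\<^sup>1 h = Q h\<close> vanishes outside \<open>K\<close>. Conversely, if \<open>V\<^sup>-\<^sup>1 h\<close> vanishes outside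
  \<open>K\<close>, it solves the system that characterises \<open>Q h\<close>.
\<close>

lemma Q_op_residual_eq_0_iff:
  fixes V :: "real ^ 'p ^ 'p"
  assumes V: "pos_def V" and inv: "invertible V"
  shows "(mat 1 - V ** Q_op V K) *v h = 0 \<longleftrightarrow> matrix_inv V *v h \<in> supported_on K"
proof -
  have "(mat 1 - V ** Q_op V K) *v h = h - V *v (Q_op V K *v h)"
    by (simp add: matrix_vector_mult_diff_rdistrib matrix_vector_mul_assoc)
  moreover have "h = V *v (Q_op V K *v h) \<longleftrightarrow> matrix_inv V *v h = Q_op V K *v h"
    by (metis matrix_inv_cancel inv)
  moreover have "matrix_inv V *v h = Q_op V K *v h" if "matrix_inv V *v h \<in> supported_on K"
    by (rule restricted_solution_unique[OF V that])
      (simp_all add: Q_op_solves[OF V] matrix_inv_cancel[OF inv])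
  ultimately show ?thesis
    by (metis Q_op_solves(1)[OF V] right_minus_eq)
qed

section \<open>Ranges\<close>

lemma sum_matrix_vector_mult:
  fixes f :: "'i \<Rightarrow> real ^ 'n ^ 'm"
  shows "(\<Sum>i\<in>A. f i) *v x = (\<Sum>i\<in>A. f i *v x)"
  by (induction A rule: infinite_finite_induct) (simp_all add: matrix_vector_mult_add_rdistrib)

lemma tensor_sum_vector_mult:
  "(\<Sum>l\<in>A. w l *\<^sub>R tensor (u l) (u l)) *v x = (\<Sum>l\<in>A. (w l * (u l \<bullet> x)) *\<^sub>R u l)"
  by (simp add: sum_matrix_vector_mult tensor_vector_mult flip: scaleR_matrix_vector_assoc)

lemma tensor_sum_form:
  "x \<bullet> ((\<Sum>l\<in>A. w l *\<^sub>R tensor (u l) (u l)) *v x) = (\<Sum>l\<in>A. w l * (u l \<bullet> x)\<^sup>2)"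
  by (simp add: tensor_sum_vector_mult inner_sum_right power2_eq_square inner_commute mult.assoc)

text \<open>
  The component of \<open>u l\<close> orthogonal to the range is a zero of the quadratic form. All
  terms of the form are nonnegative, so this component is orthogonal to \<open>u l\<close>, hence is \<open>0\<close>.
\<close>

lemma mem_range_tensor_sum:
  fixes u :: "'i \<Rightarrow> real ^ 'p"
  assumes "finite A" "\<And>l. l \<in> A \<Longrightarrow> w l > 0" "l \<in> A"
  shows "u l \<in> range ((*v) (\<Sum>l\<in>A. w l *\<^sub>R tensor (u l) (u l)))"
proof -
  define B where "B = (\<Sum>l\<in>A. w l *\<^sub>R tensor (u l) (u l))"
  have sub: "subspace (range ((*v) B))"
    by (intro linear_subspace_image) auto
  obtain s z where s: "s \<in> span (range ((*v) B))" and z: "\<And>y. y \<in> span (range ((*v) B)) \<Longrightarrow> orthogonal z y"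
      and sz: "u l = s + z"
    using orthogonal_subspace_decomp_exists by metis
  have "z \<bullet> (B *v z) = 0"
    using z[of "B *v z"] by (simp add: span_base orthogonal_def)
  then have "(\<Sum>k\<in>A. w k * (u k \<bullet> z)\<^sup>2) = 0"
    by (simp add: B_def tensor_sum_form)
  then have "w l * (u l \<bullet> z)\<^sup>2 = 0"
    using assms by (subst (asm) sum_nonneg_eq_0_iff) (auto simp: less_imp_le)
  then have "u l \<bullet> z = 0"
    using assms(2)[OF assms(3)] by simp
  moreover have "s \<bullet> z = 0"
    using z[OF s] by (simp add: orthogonal_def inner_commute)
  ultimately have "z = 0"
    by (simp add: sz inner_add_left)
  then show ?thesis
    using s sub unfolding sz B_def[symmetric] by (simp add: span_eq_iff[THEN iffD2])
qed

lemma range_tensor_sum_subset_iff: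
  fixes u :: "'i \<Rightarrow> real ^ 'p" and C :: "real ^ 'p ^ 'n"
  assumes "finite A" "\<And>l. l \<in> A \<Longrightarrow> w l > 0" "subspace S"
  shows "range ((*v) (C ** (\<Sum>l\<in>A. w l *\<^sub>R tensor (u l) (u l)))) \<subseteq> S \<longleftrightarrow> (\<forall>l\<in>A. C *v u l \<in> S)"
    (is "range ((*v) (C ** ?B)) \<subseteq> S \<longleftrightarrow> _")
proof
  assume S: "range ((*v) (C ** ?B)) \<subseteq> S"
  show "\<forall>l\<in>A. C *v u l \<in> S"
  proof
    fix l assume "l \<in> A"
    then obtain x where "u l = ?B *v x"
      using mem_range_tensor_sum[of A w l u] assms by blast
    then have "C *v u l = (C ** ?B) *v x"
      by (simp add: matrix_vector_mul_assoc)
    then show "C *v u l \<in> S"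
      using S by auto
  qed
next
  assume S: "\<forall>l\<in>A. C *v u l \<in> S"
  have "(C ** ?B) *v x = (\<Sum>l\<in>A. (w l * (u l \<bullet> x)) *\<^sub>R (C *v u l))" for x
    by (simp add: tensor_sum_vector_mult linear_sum[OF matrix_vector_mul_linear]
        matrix_vector_mult_scaleR flip: matrix_vector_mul_assoc)
  then show "range ((*v) (C ** ?B)) \<subseteq> S"
    using S assms(3) by (auto intro!: subspace_sum subspace_scale)
qed

section \<open>Ordered eigenbases\<close>

lemma ordered_eigenbasis_span:
  fixes T :: "real ^ 'p ^ 'p"
  assumes "ordered_eigenbasis T lam v"
  shows "span (v ` {1..CARD('p)}) = UNIV"
proof -
  have "card (v ` {1..CARD('p)}) = dim (UNIV :: (real ^ 'p) set)"
    using assms by (simp add: ordered_eigenbasis_def card_image)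
  then show ?thesis
    using assms card_eq_dim[of "v ` {1..CARD('p)}" UNIV] by (auto simp: ordered_eigenbasis_def)
qed

text \<open>
  An eigenvector with nonzero eigenvalue is its own image up to scaling, so it lies in the range.
  Conversely the preimage of the subspace is a subspace that contains a basis.
\<close>

lemma eigenbasis_range_subset_iff:
  fixes T :: "real ^ 'p ^ 'p"
  assumes eb: "ordered_eigenbasis T lam v" and S: "subspace S"
  shows "range ((*v) T) \<subseteq> S \<longleftrightarrow> (\<forall>i\<in>{1..CARD('p)}. lam i \<noteq> 0 \<longrightarrow> v i \<in> S)"
proof
  assume R: "range ((*v) T) \<subseteq> S"
  show "\<forall>i\<in>{1..CARD('p)}. lam i \<noteq> 0 \<longrightarrow> v i \<in> S"
  proof (intro ballI impI)
    fix i assume i: "i \<in> {1..CARD('p)}" "lam i \<noteq> 0"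
    then have "v i = T *v (inverse (lam i) *\<^sub>R v i)"
      using eb by (simp add: ordered_eigenbasis_def matrix_vector_mult_scaleR)
    then show "v i \<in> S"
      using R by (metis rangeI subsetD)
  qed
next
  assume v: "\<forall>i\<in>{1..CARD('p)}. lam i \<noteq> 0 \<longrightarrow> v i \<in> S"
  have sub: "subspace ((*v) T -` S)"
    using S by (intro linear_subspace_vimage) auto
  have "T *v v i \<in> S" if "i \<in> {1..CARD('p)}" for i
    using v that eb S
    by (cases "lam i = 0") (auto simp: ordered_eigenbasis_def subspace_0 subspace_scale)
  then have "span (v ` {1..CARD('p)}) \<subseteq> (*v) T -` S"
    using sub by (intro span_minimal) auto
  then show "range ((*v) T) \<subseteq> S"
    using ordered_eigenbasis_span[OF eb] by auto
qed

lemma rank_eq_card_nonzero_eigenvalues: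
  fixes T :: "real ^ 'p ^ 'p"
  assumes eb: "ordered_eigenbasis T lam v"
  shows "rank T = card {i \<in> {1..CARD('p)}. lam i \<noteq> 0}"
proof -
  define J where "J = {i \<in> {1..CARD('p)}. lam i \<noteq> 0}"
  have J: "J \<subseteq> {1..CARD('p)}"
    by (auto simp: J_def)
  have sub: "subspace (range ((*v) T))"
    by (intro linear_subspace_image) auto
  have "range ((*v) T) \<subseteq> span (v ` J)"
    by (subst eigenbasis_range_subset_iff[OF eb subspace_span]) (auto simp: J_def intro: span_base)
  moreover have "span (v ` J) \<subseteq> range ((*v) T)"
    using eigenbasis_range_subset_iff[OF eb sub] by (intro span_minimal[OF _ sub]) (auto simp: J_def)
  ultimately have "rank T = dim (span (v ` J))"
    by (simp add: rank_dim_range)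
  also have "\<dots> = card (v ` J)"
  proof (rule dim_span_eq_card_independent)
    show "independent (v ` J)"
      using eb J independent_mono[OF _ image_mono[OF J, of v]]
      by (simp add: ordered_eigenbasis_def)
  qed
  also have "\<dots> = card J"
    using eb inj_on_subset[OF _ J, of v] by (simp add: ordered_eigenbasis_def card_image)
  finally show ?thesis
    by (simp add: J_def)
qed

lemma downward_closed_eq_atLeastAtMost_card:
  fixes J :: "nat set"
  assumes "J \<subseteq> {1..n}" and down: "\<And>i j. j \<in> J \<Longrightarrow> 1 \<le> i \<Longrightarrow> i \<le> j \<Longrightarrow> i \<in> J"
  shows "J = {1..card J}"
proof (cases "J = {}")
  case False
  have fin: "finite J"
    using assms(1) finite_subset by blast
  then have "J \<subseteq> {1..Max J}"
    using assms(1) by (fastforce intro: Max_ge)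
  moreover have "{1..Max J} \<subseteq> J"
    using down[OF Max_in[OF fin False]] by auto
  ultimately have "J = {1..Max J}"
    by (rule antisym)
  then show ?thesis
    using card_atLeastAtMost[of 1 "Max J"] by simp
qed simp

text \<open>
  With nonnegative eigenvalues in decreasing order, everything before a nonzero eigenvalue is
  nonzero. In general negative eigenvalues could follow the zeros, and the first \<open>rank T\<close>
  eigenvectors would not be those with nonzero eigenvalue.
\<close>

lemma ordered_eigenbasis_nonzero:
  fixes T :: "real ^ 'p ^ 'p"
  assumes eb: "ordered_eigenbasis T lam v"
    and nonneg: "\<And>i. i \<in> {1..CARD('p)} \<Longrightarrow> lam i \<ge> 0"
  shows "{i \<in> {1..CARD('p)}. lam i \<noteq> 0} = {1..rank T}"
  unfolding rank_eq_card_nonzero_eigenvalues[OF eb]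
proof (rule downward_closed_eq_atLeastAtMost_card)
  fix i j assume j: "j \<in> {i \<in> {1..CARD('p)}. lam i \<noteq> 0}" and i: "1 \<le> i" "i \<le> j"
  then have "lam j > 0" "lam j \<le> lam i"
    using nonneg[of j] eb by (auto simp: ordered_eigenbasis_def)
  then show "i \<in> {i \<in> {1..CARD('p)}. lam i \<noteq> 0}"
    using i j by auto
qed auto

lemma relevant_cell_subset_iff:
  fixes T :: "real ^ 'p ^ 'p"
  assumes "ordered_eigenbasis T lam v" "\<And>i. i \<in> {1..CARD('p)} \<Longrightarrow> lam i \<ge> 0"
  shows "relevant_cell T v \<subseteq> K \<longleftrightarrow> range ((*v) T) \<subseteq> supported_on K"
proof -
  have "relevant_cell T v \<subseteq> K \<longleftrightarrow> (\<forall>i\<in>{1..rank T}. v i \<in> supported_on K)"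
    by (auto simp: relevant_cell_def supported_on_def)
  also have "\<dots> \<longleftrightarrow> range ((*v) T) \<subseteq> supported_on K"
    unfolding eigenbasis_range_subset_iff[OF assms(1) subspace_supported_on]
    by (subst ordered_eigenbasis_nonzero[OF assms, symmetric]) auto
  finally show ?thesis .
qed

text \<open>
  Pair the eigenvalue equation, multiplied by \<open>V\<close>, with the eigenvector: \<open>\<langle>x, B x\<rangle> = c \<langle>x, V x\<rangle>\<close>.
\<close>

lemma generalized_eigenvalue_nonneg:
  fixes V B :: "real ^ 'p ^ 'p"
  assumes V: "pos_def V" "invertible V" and B: "x \<bullet> (B *v x) \<ge> 0"
    and x: "x \<noteq> 0" "(matrix_inv V ** B) *v x = c *\<^sub>R x"
  shows "c \<ge> 0"
proof -
  have "B *v x = V *v ((matrix_inv V ** B) *v x)"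
    by (simp add: matrix_inv_cancel[OF V(2)] flip: matrix_vector_mul_assoc)
  then have "x \<bullet> (B *v x) = c * (x \<bullet> (V *v x))"
    by (simp add: x matrix_vector_mult_scaleR)
  then show ?thesis
    using B V(1) x(1) unfolding pos_def_def by (metis not_less zero_le_mult_iff)
qed

section \<open>The criterion and the relevant indices\<close>

theorem proposition1:
  fixes P :: "'a measure"
    and X :: "'a \<Rightarrow> real ^ 'p"
    and Y :: "nat \<Rightarrow> 'a \<Rightarrow> nat"
    and Z U :: "'a \<Rightarrow> nat"
    and d q M :: nat
    and lam :: "nat \<Rightarrow> nat \<Rightarrow> real"
    and v :: "nat \<Rightarrow> nat \<Rightarrow> real ^ 'p"
    and K :: "'p set"
  assumes "prob_space P"
    and "X \<in> borel_measurable P"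
    and "integrable P (\<lambda>\<omega>. norm (X \<omega>) ^ 4)"
    and "\<And>j. j \<in> {1..d} \<Longrightarrow> Y j \<in> P \<rightarrow>\<^sub>M count_space {0, 1}"
    and "q \<ge> 2"
    and "Z \<in> P \<rightarrow>\<^sub>M count_space {1..q}"
    and "M = 2 ^ d"
    and "U = cell d Y"
    and "\<And>m. m \<in> {1..M} \<Longrightarrow> cell_prob P U m > 0"
    and "\<And>l m. l \<in> {1..q} \<Longrightarrow> m \<in> {1..M} \<Longrightarrow> group_prob P U Z l m > 0"
    and "\<And>m. m \<in> {1..M} \<Longrightarrow> invertible (cell_cov P X U m)"
    and "\<And>m. m \<in> {1..M} \<Longrightarrow> ordered_eigenbasis (discr_op P X U Z q m) (lam m) (v m)"
  shows "xi P X U Z q M K = 0 \<longleftrightarrow> relevant M (discr_op P X U Z q) v \<subseteq> K"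
proof -
  have cell: "xi_cell P X U Z q K m = 0 \<longleftrightarrow> relevant_cell (discr_op P X U Z q m) (v m) \<subseteq> K"
    if m: "m \<in> {1..M}" for m
  proof -
    define V where "V = cell_cov P X U m"
    define w where "w l = group_prob P U Z l m" for l
    define u where "u l = group_mean P X U Z l m - cell_mean P X U m" for l
    define B where "B = (\<Sum>l = 1..q. w l *\<^sub>R tensor (u l) (u l))"
    have T: "discr_op P X U Z q m = matrix_inv V ** B"
      by (simp add: discr_op_def between_cov_def V_def B_def w_def u_def)
    have inv: "invertible V"
      using assms(11)[OF m] by (simp add: V_def)
    then have V: "pos_def V"
      unfolding V_def by (intro invertible_psd_imp_pos_def cell_cov_symmetric cell_cov_psd)
    have w: "w l > 0" if "l \<in> {1..q}" for l
      using assms(10)[OF that m] by (simp add: w_def)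
    have eb: "ordered_eigenbasis (matrix_inv V ** B) (lam m) (v m)"
      using assms(12)[OF m] by (simp add: T)
    have B: "x \<bullet> (B *v x) \<ge> 0" for x
      unfolding B_def tensor_sum_form using w by (intro sum_nonneg) (simp add: less_imp_le)
    have "lam m i \<ge> 0" if "i \<in> {1..CARD('p)}" for i
      using eb that generalized_eigenvalue_nonneg[OF V inv B]
      unfolding ordered_eigenbasis_def by blast
    then have rel: "relevant_cell (discr_op P X U Z q m) (v m) \<subseteq> K \<longleftrightarrow>
        range ((*v) (matrix_inv V ** B)) \<subseteq> supported_on K"
      unfolding T by (intro relevant_cell_subset_iff[OF eb])
    have "xi_cell P X U Z q K m =
        (\<Sum>l = 1..q. (w l)\<^sup>2 * (norm ((mat 1 - V ** Q_op V K) *v u l))\<^sup>2)"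
      by (simp add: xi_cell_def V_def w_def u_def)
    also have "\<dots> = 0 \<longleftrightarrow> (\<forall>l\<in>{1..q}. (mat 1 - V ** Q_op V K) *v u l = 0)"
      using w by (subst sum_nonneg_eq_0_iff) fastforce+
    also have "\<dots> \<longleftrightarrow> (\<forall>l\<in>{1..q}. matrix_inv V *v u l \<in> supported_on K)"
      by (simp add: Q_op_residual_eq_0_iff[OF V inv])
    also have "\<dots> \<longleftrightarrow> range ((*v) (matrix_inv V ** B)) \<subseteq> supported_on K"
      unfolding B_def
      by (subst range_tensor_sum_subset_iff) (simp_all add: w subspace_supported_on)
    finally show ?thesis
      using rel by simp
  qed
  have "xi_cell P X U Z q K m \<ge> 0" for m
    unfolding xi_cell_def by (intro sum_nonneg) simp
  then have "xi P X U Z q M K = 0 \<longleftrightarrow>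
      (\<forall>m\<in>{1..M}. (cell_prob P U m)\<^sup>2 * xi_cell P X U Z q K m = 0)"
    unfolding xi_def by (intro sum_nonneg_eq_0_iff) simp_all
  also have "\<dots> \<longleftrightarrow> (\<forall>m\<in>{1..M}. xi_cell P X U Z q K m = 0)"
    using assms(9) by fastforce
  also have "\<dots> \<longleftrightarrow> relevant M (discr_op P X U Z q) v \<subseteq> K"
    using cell by (auto simp: relevant_def)
  finally show ?thesis .
qed

end
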